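(* Let $$\Phi(R,v_1,v_2,v_3)=\alpha(R)\sum_{i=1}^3\phi(v_i)+h(v_1v_2v_3),$$ where $\alpha$ is a smooth positive function on $[0,1]$, $\phi$ is a nonnegative convex function and $h$ is a strictly convex function on $(0,\infty)$ (both differentiable). Let $d_0$ be the value of the argument at which $h$ assumes its global minimum value. Assume that $\alpha'(R)\le0$ for all $R$ and that $\phi'(t)\ge0$ for all $t$. Let $\lambda>0$ and let $r$ be a minimizer of $I$ over $\mathcal{A}_\lambda$. If $\lambda^3<d_0$, then $r(0)=0$.
   Context: The reference mass density $\rho_0:[0,1]\to\mathbb{R}$ satisfies $k_0\le\rho_0(R)\le k_1$ for $0\le R\le 1$, with positive constants $k_0,k_1$, and $M_R=4\pi\int_0^R\rho_0(u)u^2\,du$. Define $$I(r)=I_{\rm mec}(r)-I_{\rm pot}(r),\quad I_{\rm mec}(r)=\int_0^1\Phi\left(R,r'(R),\tfrac{r(R)}{R},\tfrac{r(R)}{R}\right)R^2\,dR,\quad I_{\rm pot}(r)=\int_0^1\rho_0(R)\frac{M_R}{r(R)}R^2\,dR,$$ and $$\mathcal{A}_\lambda=\{r\in W^{1,1}(0,1): r(1)=\lambda,\ r'(R)>0\text{ for a.e. }R\in(0,1),\ r(0)\ge0,\ I_{\rm mec}(r)<\infty\}.$$ Standing assumption: $\Phi(R,v_1,v_2,v_3)\ge\hat\phi(v_1)+\hat\phi(v_2)+\hat\phi(v_3)+\hat h(v_1v_2v_3)$ for all $R\in[0,1]$, $v_i>0$, for some strictly convex $\hat\phi,\hat h:(0,\infty)\to(0,\infty)$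 with $\hat\phi(v)\ge Cv^{q}$ for some $C>0$ and $1<q<3$; $\hat h(d)/d\to\infty$ as $d\to\infty$; and $\hat h(d)\ge Kd^{-s}$ for all $d>0$, for some $K>0$ and $s\ge\frac{q}{q-1}$. *)

theory Defs
  imports "HOL-Analysis.Analysis"
begin

definition strictly_convex_on :: "real set \<Rightarrow> (real \<Rightarrow> real) \<Rightarrow> bool" where
  "strictly_convex_on S f \<longleftrightarrow> convex S \<and>
     (\<forall>x\<in>S. \<forall>y\<in>S. \<forall>t. x \<noteq> y \<longrightarrow> 0 < t \<longrightarrow> t < 1 \<longrightarrow>
        f ((1 - t) * x + t * y) < (1 - t) * f x + t * f y)"

text \<open>The derivatives are taken within \<open>S\<close>, hence are one-sided at the endpoints
  of a closed interval.\<close>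

definition smooth_within :: "real set \<Rightarrow> (real \<Rightarrow> real) \<Rightarrow> bool" where
  "smooth_within S f \<longleftrightarrow>
     (\<exists>D :: nat \<Rightarrow> real \<Rightarrow> real. (\<forall>x\<in>S. D 0 x = f x) \<and>
        (\<forall>n. \<forall>x\<in>S. (D n has_real_derivative D (Suc n) x) (at x within S)))"

text \<open>Test functions are \<open>C\<^sup>1\<close> with compact support, as in Brezis' textbook;
  on an open interval \<open>C\<^sup>\<infinity>\<close> test functions yield the same weak derivatives.\<close>

definition test_function_on :: "real set \<Rightarrow> (real \<Rightarrow> real) \<Rightarrow> bool" where
  "test_function_on S \<psi> \<longleftrightarrow> \<psi> C1_differentiable_on UNIV \<and>
     compact (closure {x. \<psi> x \<noteq> 0}) \<and> closure {x. \<psi> x \<noteq> 0} \<subseteq> S"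

definition has_L1_weak_derivative_on :: "(real \<Rightarrow> real) \<Rightarrow> (real \<Rightarrow> real) \<Rightarrow> real set \<Rightarrow> bool" where
  "has_L1_weak_derivative_on f g S \<longleftrightarrow>
     f absolutely_integrable_on S \<and> g absolutely_integrable_on S \<and>
     (\<forall>\<psi>. test_function_on S \<psi> \<longrightarrow>
        (LINT x:S|lebesgue. f x * deriv \<psi> x) = - (LINT x:S|lebesgue. g x * \<psi> x))"

text \<open>The space \<open>W\<^sup>1\<^sup>,\<^sup>1(0,1)\<close>. As the boundary values \<open>r(0)\<close> and \<open>r(1)\<close> are used, each class
  is represented by its representative that is continuous on \<open>[0,1]\<close>; the values of a function
  outside \<open>[0,1]\<close> are irrelevant.\<close>

definition W11 :: "(real \<Rightarrow> real) set" where
  "W11 = {r. continuous_on {0..1} r \<and> (\<exists>g. has_L1_weak_derivative_on r g {0<..<1})}"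

text \<open>Unique up to null sets, which is all that matters below.\<close>

definition weak_deriv :: "(real \<Rightarrow> real) \<Rightarrow> real \<Rightarrow> real" where
  "weak_deriv r = (SOME g. has_L1_weak_derivative_on r g {0<..<1})"

definition mass :: "(real \<Rightarrow> real) \<Rightarrow> real \<Rightarrow> real" where
  "mass \<rho>0 R = 4 * pi * (LINT u:{0..R}|lebesgue. \<rho>0 u * u\<^sup>2)"

text \<open>Both integrands are nonnegative almost everywhere for admissible \<open>r\<close>, so the truncation
  in \<open>ennreal\<close> has no effect, and the integrals are allowed to be infinite.\<close>

definition I_mec :: "(real \<Rightarrow> real \<Rightarrow> real \<Rightarrow> real \<Rightarrow> real) \<Rightarrow> (real \<Rightarrow> real) \<Rightarrow> ennreal" where
  "I_mec \<Phi> r =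
     (\<integral>\<^sup>+ R\<in>{0<..<1}. ennreal (\<Phi> R (weak_deriv r R) (r R / R) (r R / R) * R\<^sup>2) \<partial>lebesgue)"

definition I_pot :: "(real \<Rightarrow> real) \<Rightarrow> (real \<Rightarrow> real) \<Rightarrow> ennreal" where
  "I_pot \<rho>0 r = (\<integral>\<^sup>+ R\<in>{0<..<1}. ennreal (\<rho>0 R * (mass \<rho>0 R / r R) * R\<^sup>2) \<partial>lebesgue)"

definition I_total ::
  "(real \<Rightarrow> real \<Rightarrow> real \<Rightarrow> real \<Rightarrow> real) \<Rightarrow> (real \<Rightarrow> real) \<Rightarrow> (real \<Rightarrow> real) \<Rightarrow> ereal" where
  "I_total \<Phi> \<rho>0 r = enn2ereal (I_mec \<Phi> r) - enn2ereal (I_pot \<rho>0 r)"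

definition admissible ::
  "(real \<Rightarrow> real \<Rightarrow> real \<Rightarrow> real \<Rightarrow> real) \<Rightarrow> real \<Rightarrow> (real \<Rightarrow> real) set" where
  "admissible \<Phi> lam =
     {r \<in> W11. r 1 = lam \<and> (AE R in lebesgue. R \<in> {0<..<1} \<longrightarrow> weak_deriv r R > 0) \<and>
        r 0 \<ge> 0 \<and> I_mec \<Phi> r < \<infinity>}"

end

theory Submission
  imports Defs
begin

text \<open>Suppose that \<open>r(0) > 0\<close>, let \<open>c\<close> be the first point with \<open>r(c) = \<lambda> c\<close>, and let \<open>v\<close> be \<open>\<lambda> R\<close> on
  \<open>[0, c]\<close> and \<open>r\<close> on \<open>[c, 1]\<close>. Since \<open>v \<le> r\<close>, the potential term does not decrease. On \<open>[0, c]\<close> the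
  tangent lines of \<open>\<phi>\<close> at \<open>\<lambda>\<close> and of \<open>h\<close> at \<open>\<lambda>\<^sup>3\<close> bound the mechanical energy of \<open>r\<close> minus that of
  \<open>v\<close> from below by
  \<open>\<phi>'(\<lambda>) \<integral>\<alpha> (R\<^sup>2 (r - \<lambda> R))' + h'(\<lambda>\<^sup>3) \<integral>(r\<^sup>3 - \<lambda>\<^sup>3 R\<^sup>3)' / 3\<close>. The first term equals
  \<open>-\<phi>'(\<lambda>) \<integral>\<alpha>' R\<^sup>2 (r - \<lambda> R) \<ge> 0\<close>, and the second \<open>-h'(\<lambda>\<^sup>3) r(0)\<^sup>3 / 3 > 0\<close> because \<open>h\<close> is strictly
  decreasing to the left of \<open>d\<^sub>0\<close>. So \<open>v\<close> has smaller energy than \<open>r\<close>.\<close>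

subsection \<open>Primitives of integrable functions\<close>

text \<open>Absolute continuity of \<open>u\<close> on \<open>{a..b}\<close> in integral form. The
  density \<open>f\<close> is an explicit argument, so that sign conditions on derivatives can be
  imposed almost everywhere and the product rule can be written as a formula for densities.\<close>

definition L1_primitive :: "real \<Rightarrow> real \<Rightarrow> (real \<Rightarrow> real) \<Rightarrow> (real \<Rightarrow> real) \<Rightarrow> bool" where
  "L1_primitive a b u f \<longleftrightarrow>
     f absolutely_integrable_on {a..b} \<and> (\<forall>x\<in>{a..b}. u x = u a + integral {a..x} f)"

lemma L1_primitiveD:
  assumes "L1_primitive a b u f"
  shows "f absolutely_integrable_on {a..b}" "f integrable_on {a..b}"
    and "x \<in> {a..b} \<Longrightarrow> u x = u a + integral {a..x} f"
proof -
  show f: "f absolutely_integrable_on {a..b}"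
    using assms unfolding L1_primitive_def by (rule conjunct1)
  show "f integrable_on {a..b}"
    using f by (rule set_lebesgue_integral_eq_integral(1))
  show "x \<in> {a..b} \<Longrightarrow> u x = u a + integral {a..x} f"
    using assms unfolding L1_primitive_def by (elim conjE) (rule bspec)
qed

text \<open>Summing the increment bound over \<open>n\<close> equal steps shorter than \<delta>
  telescopes to \<open>\<bar>E b - E a\<bar> \<le> \<epsilon> * (G b - G a)\<close>, and \<epsilon>
  is arbitrary. This yields the product rule for primitives without any pointwise
  differentiation.\<close>

lemma small_increments_imp_eq:
  fixes E G :: "real \<Rightarrow> real"
  assumes "a \<le> b"
    and small: "\<And>\<epsilon>. \<epsilon> > 0 \<Longrightarrow> \<exists>\<delta>>0. \<forall>x y. a \<le> x \<longrightarrow> x \<le> y \<longrightarrow> y \<le> b \<longrightarrow> y - x < \<delta> \<longrightarrow>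
                  \<bar>E y - E x\<bar> \<le> \<epsilon> * (G y - G x)"
  shows "E b = E a"
proof -
  have bound: "\<bar>E b - E a\<bar> \<le> \<epsilon> * (G b - G a)" if e: "\<epsilon> > 0" for \<epsilon>
  proof -
    obtain \<delta> where "\<delta> > 0" and \<delta>: "\<And>x y. a \<le> x \<Longrightarrow> x \<le> y \<Longrightarrow> y \<le> b \<Longrightarrow> y - x < \<delta> \<Longrightarrow>
                  \<bar>E y - E x\<bar> \<le> \<epsilon> * (G y - G x)"
      using small[OF e] by blast
    obtain n :: nat where n: "n > 0" "(b - a) / n < \<delta>"
    proof -
      obtain n :: nat where "(b - a) / \<delta> < real n" using reals_Archimedean2 by blast
      moreover have "real n > 0" using calculation \<open>a \<le> b\<close> \<open>\<delta> > 0\<close>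
        by (metis diff_ge_0_iff_ge divide_nonneg_pos order_le_less_trans)
      ultimately show thesis using that[of n] \<open>\<delta> > 0\<close> by (simp add: field_simps)
    qed
    define x where "x i = a + real i * ((b - a) / n)" for i
    have h0: "(b - a) / n \<ge> 0" using \<open>a \<le> b\<close> by simp
    have xb: "x i \<le> b" if "i \<le> n" for i
    proof -
      have "real i * ((b - a) / n) \<le> real n * ((b - a) / n)"
        using that h0 by (intro mult_right_mono) auto
      then show ?thesis using n by (simp add: x_def)
    qed
    have "\<bar>E (x i) - E a\<bar> \<le> \<epsilon> * (G (x i) - G a)" if "i \<le> n" for i
      using that
    proof (induction i)
      case 0
      then show ?case by (simp add: x_def)
    next
      case (Suc i)
      have st: "x (Suc i) - x i = (b - a) / n"
        by (simp add: x_def algebra_simps add_divide_distrib diff_divide_distrib)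
      have "a \<le> x i" unfolding x_def using mult_nonneg_nonneg[OF of_nat_0_le_iff h0] by simp
      moreover have "x i \<le> x (Suc i)" using st h0 by simp
      ultimately have "\<bar>E (x (Suc i)) - E (x i)\<bar> \<le> \<epsilon> * (G (x (Suc i)) - G (x i))"
        using \<delta>[of "x i" "x (Suc i)"] xb[OF Suc.prems] n st by simp
      moreover have "\<bar>E (x i) - E a\<bar> \<le> \<epsilon> * (G (x i) - G a)" using Suc by simp
      ultimately show ?case by (simp add: algebra_simps)
    qed
    from this[of n] show ?thesis using n by (simp add: x_def)
  qed
  have "\<bar>E b - E a\<bar> \<le> 0"
  proof (rule field_le_epsilon)
    fix e :: real assume "e > 0"
    \<comment> \<open>The summand 1 keeps the divisor positive even if
      \<open>G b = G a\<close>.\<close>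
    define c where "c = \<bar>G b - G a\<bar> + 1"
    have "c > 0" by (simp add: c_def add_nonneg_pos)
    have "\<bar>E b - E a\<bar> \<le> e / c * (G b - G a)"
      using bound[of "e / c"] \<open>e > 0\<close> \<open>c > 0\<close> by simp
    also have "\<dots> \<le> e / c * c"
      using \<open>e > 0\<close> \<open>c > 0\<close> by (intro mult_left_mono) (auto simp: c_def)
    finally show "\<bar>E b - E a\<bar> \<le> 0 + e" using \<open>c > 0\<close> by simp
  qed
  then show ?thesis by simp
qed

lemma L1_primitive_subinterval:
  assumes "L1_primitive a b u f" "a \<le> x" "x \<le> y" "y \<le> b"
  shows "f absolutely_integrable_on {x..y}" "u y - u x = integral {x..y} f"
proof -
  note f = L1_primitiveD(1)[OF assms(1)]
  show "f absolutely_integrable_on {x..y}"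
    using absolutely_integrable_on_subinterval[OF f] assms by auto
  have "f integrable_on {a..y}"
    using absolutely_integrable_on_subinterval[OF f, of a y] assms
    by (auto dest: set_lebesgue_integral_eq_integral(1))
  then have "integral {a..x} f + integral {x..y} f = integral {a..y} f"
    using assms by (intro Henstock_Kurzweil_Integration.integral_combine) auto
  moreover have "u y = u a + integral {a..y} f" "u x = u a + integral {a..x} f"
    by (rule L1_primitiveD(3)[OF assms(1)]; use assms(2-) in simp)+
  ultimately show "u y - u x = integral {x..y} f" by simp
qed

lemma L1_primitive_continuous:
  assumes "L1_primitive a b u f"
  shows "continuous_on {a..b} u"
proof -
  have "continuous_on {a..b} (\<lambda>x. u a + integral {a..x} f)"
    by (intro continuous_intros indefinite_integral_continuous_1 L1_primitiveD(2)[OF assms])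
  then show ?thesis
    by (rule continuous_on_eq) (rule L1_primitiveD(3)[OF assms, symmetric])
qed

lemma absolutely_integrable_continuous_mult:
  fixes w f :: "real \<Rightarrow> real"
  assumes "continuous_on {a..b} w" "f absolutely_integrable_on {a..b}"
  shows "(\<lambda>x. w x * f x) absolutely_integrable_on {a..b}"
    and "(\<lambda>x. f x * w x) absolutely_integrable_on {a..b}"
proof -
  have "bounded (w ` {a..b})"
    by (intro compact_imp_bounded compact_continuous_image assms(1)) simp
  moreover have "w \<in> borel_measurable (lebesgue_on {a..b})"
    by (rule continuous_imp_measurable_on_sets_lebesgue[OF assms(1)]) simp
  ultimately show "(\<lambda>x. w x * f x) absolutely_integrable_on {a..b}"
    using assms(2) by (intro absolutely_integrable_bounded_measurable_product_real) simp_all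
  then show "(\<lambda>x. f x * w x) absolutely_integrable_on {a..b}"
    by (simp add: mult.commute)
qed

text \<open>On a short interval \<open>[x, y]\<close> one has \<open>\<Delta>(u v) = v(y) \<integral>f + u(x) \<integral>g\<close>, which differs from
  \<open>\<integral>(f v + u g)\<close> by at most \<open>\<epsilon> \<integral>(\<bar>f\<bar> + \<bar>g\<bar>)\<close>.\<close>

lemma L1_primitive_mult:
  assumes u: "L1_primitive a b u f" and v: "L1_primitive a b v g"
  shows "L1_primitive a b (\<lambda>x. u x * v x) (\<lambda>x. f x * v x + u x * g x)"
proof -
  define k where "k = (\<lambda>x. f x * v x + u x * g x)"
  define m where "m = (\<lambda>x. \<bar>f x\<bar> + \<bar>g x\<bar>)"
  note cu = L1_primitive_continuous[OF u] and cv = L1_primitive_continuous[OF v]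
  note f = L1_primitiveD(1)[OF u] and g = L1_primitiveD(1)[OF v]
  note fi = L1_primitiveD(2)[OF u] and gi = L1_primitiveD(2)[OF v]
  have k: "k absolutely_integrable_on {a..b}" unfolding k_def
    by (intro set_integral_add absolutely_integrable_continuous_mult cu cv f g)
  then have ki: "k integrable_on {a..b}" by (auto dest: set_lebesgue_integral_eq_integral(1))
  have "m absolutely_integrable_on {a..b}" unfolding m_def
    by (intro set_integral_add set_integrable_abs f g)
  then have mi: "m integrable_on {a..b}" by (auto dest: set_lebesgue_integral_eq_integral(1))
  have "u c * v c = u a * v a + integral {a..c} k" if c: "c \<in> {a..b}" for c
  proof -
    \<comment> \<open>\<open>E\<close> is the defect of the product formula, so the claim is
      \<open>E c = E a\<close>; the increments of \<open>G\<close> are the integrals of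
      \<open>\<bar>f\<bar> + \<bar>g\<bar>\<close>.\<close>
    define E where "E x = integral {a..x} k - u x * v x" for x
    define G where "G x = integral {a..x} m" for x
    have "E c = E a"
    proof (rule small_increments_imp_eq[where E = E and G = G])
      show "a \<le> c" using c by simp
      fix \<epsilon> :: real assume "\<epsilon> > 0"
      have "uniformly_continuous_on {a..b} u" "uniformly_continuous_on {a..b} v"
        using cu cv by (auto intro: compact_uniformly_continuous)
      note uc = this
      obtain d1 where "d1 > 0"
        and d1: "\<And>x y. x \<in> {a..b} \<Longrightarrow> y \<in> {a..b} \<Longrightarrow> dist y x < d1 \<Longrightarrow> dist (u y) (u x) < \<epsilon>"
        using uc(1)[unfolded uniformly_continuous_on_def] \<open>\<epsilon> > 0\<close> by blast
      obtain d2 where "d2 > 0"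
        and d2: "\<And>x y. x \<in> {a..b} \<Longrightarrow> y \<in> {a..b} \<Longrightarrow> dist y x < d2 \<Longrightarrow> dist (v y) (v x) < \<epsilon>"
        using uc(2)[unfolded uniformly_continuous_on_def] \<open>\<epsilon> > 0\<close> by blast
      have "\<bar>E y - E x\<bar> \<le> \<epsilon> * (G y - G x)"
        if xy: "a \<le> x" "x \<le> y" "y \<le> c" "y - x < min d1 d2" for x y
      proof -
        have yb: "y \<le> b" using xy c by simp
        have sub: "{x..y} \<subseteq> {a..b}" "{a..y} \<subseteq> {a..b}" using xy yb by auto
        note si = fi[THEN integrable_on_subinterval, OF sub(1)]
          gi[THEN integrable_on_subinterval, OF sub(1)]
          ki[THEN integrable_on_subinterval, OF sub(1)]
          mi[THEN integrable_on_subinterval, OF sub(1)]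
        have "integral {a..x} k + integral {x..y} k = integral {a..y} k"
             "integral {a..x} m + integral {x..y} m = integral {a..y} m"
          using xy ki mi sub
          by (auto intro!: Henstock_Kurzweil_Integration.integral_combine
              intro: integrable_on_subinterval)
        moreover have "u y * v y - u x * v x = (u y - u x) * v y + u x * (v y - v x)"
          by (simp add: algebra_simps)
        moreover have "u y - u x = integral {x..y} f" "v y - v x = integral {x..y} g"
          using L1_primitive_subinterval(2)[OF u, of x y] L1_primitive_subinterval(2)[OF v, of x y] xy yb by auto
        ultimately have "E y - E x = integral {x..y} k - (integral {x..y} f * v y + u x * integral {x..y} g)"
          and G: "G y - G x = integral {x..y} m"
          unfolding E_def G_def by (auto simp: algebra_simps)
        then have E: "E y - E x = integral {x..y} (\<lambda>t. k t - (f t * v y + u x * g t))"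
          using si
          by (simp add: integral_diff integral_add integrable_add integrable_on_mult_left
              integrable_on_mult_right)
        have "norm (integral {x..y} (\<lambda>t. k t - (f t * v y + u x * g t))) \<le> integral {x..y} (\<lambda>t. \<epsilon> * m t)"
        proof (rule integral_norm_bound_integral)
          show "(\<lambda>t. k t - (f t * v y + u x * g t)) integrable_on {x..y}"
            using si by (intro integrable_diff integrable_add integrable_on_mult_left integrable_on_mult_right)
          show "(\<lambda>t. \<epsilon> * m t) integrable_on {x..y}" using si(4) by (rule integrable_on_mult_right)
          fix t assume t: "t \<in> {x..y}"
          have "\<bar>v t - v y\<bar> \<le> \<epsilon>" using d2[of y t] t xy yb sub by (force simp: dist_real_def)
          moreover have "\<bar>u t - u x\<bar> \<le> \<epsilon>" using d1[of x t] t xy yb sub by (force simp: dist_real_def)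
          moreover have "k t - (f t * v y + u x * g t) = f t * (v t - v y) + (u t - u x) * g t"
            by (simp add: k_def algebra_simps)
          moreover have "\<bar>f t * (v t - v y) + (u t - u x) * g t\<bar> \<le> \<bar>f t\<bar> * \<bar>v t - v y\<bar> + \<bar>u t - u x\<bar> * \<bar>g t\<bar>"
            using abs_triangle_ineq by (metis abs_mult)
          moreover have "\<bar>f t\<bar> * \<bar>v t - v y\<bar> \<le> \<bar>f t\<bar> * \<epsilon>" "\<bar>u t - u x\<bar> * \<bar>g t\<bar> \<le> \<epsilon> * \<bar>g t\<bar>"
            using calculation(1,2) by (auto intro: mult_left_mono mult_right_mono)
          ultimately have "\<bar>k t - (f t * v y + u x * g t)\<bar> \<le> \<bar>f t\<bar> * \<epsilon> + \<epsilon> * \<bar>g t\<bar>"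
            by linarith
          then show "norm (k t - (f t * v y + u x * g t)) \<le> \<epsilon> * m t"
            by (simp add: m_def algebra_simps)
        qed
        then show ?thesis using E G by simp
      qed
      then show "\<exists>\<delta>>0. \<forall>x y. a \<le> x \<longrightarrow> x \<le> y \<longrightarrow> y \<le> c \<longrightarrow> y - x < \<delta> \<longrightarrow> \<bar>E y - E x\<bar> \<le> \<epsilon> * (G y - G x)"
        using \<open>d1 > 0\<close> \<open>d2 > 0\<close> by (intro exI[of _ "min d1 d2"]) auto
    qed
    then show ?thesis by (simp add: E_def)
  qed
  then show ?thesis using k unfolding L1_primitive_def k_def by blast
qed

lemma L1_primitive_C1:
  assumes "\<And>x. x \<in> {a..b} \<Longrightarrow> (u has_real_derivative f x) (at x within {a..b})"
    and "continuous_on {a..b} f"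
  shows "L1_primitive a b u f"
proof -
  have "u x = u a + integral {a..x} f" if "x \<in> {a..b}" for x
  proof -
    have "(f has_integral (u x - u a)) {a..x}"
      using that
      by (intro fundamental_theorem_of_calculus)
        (auto simp: has_real_derivative_iff_has_vector_derivative[symmetric]
          intro!: DERIV_subset[OF assms(1)])
    then show ?thesis by (simp add: integral_unique)
  qed
  then show ?thesis
    using absolutely_integrable_continuous_real[OF assms(2)] unfolding L1_primitive_def by blast
qed

lemma L1_primitive_diff:
  assumes "L1_primitive a b u f" "L1_primitive a b v g"
  shows "L1_primitive a b (\<lambda>x. u x - v x) (\<lambda>x. f x - g x)"
proof -
  have "integral {a..x} (\<lambda>x. f x - g x) = integral {a..x} f - integral {a..x} g" if "x \<in> {a..b}" for x
    using that L1_primitive_subinterval(1)[OF assms(1), of a x] L1_primitive_subinterval(1)[OF assms(2), of a x]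
    by (intro integral_diff set_lebesgue_integral_eq_integral(1)) auto
  then have "u x - v x = u a - v a + integral {a..x} (\<lambda>x. f x - g x)" if "x \<in> {a..b}" for x
    using L1_primitiveD(3)[OF assms(1) that] L1_primitiveD(3)[OF assms(2) that] that by simp
  then show ?thesis
    using set_integral_diff(1)[OF L1_primitiveD(1)[OF assms(1)] L1_primitiveD(1)[OF assms(2)]]
    unfolding L1_primitive_def by blast
qed

lemma L1_primitive_mono:
  assumes "L1_primitive a b u f" "a \<le> c" "c \<le> d" "d \<le> b"
  shows "L1_primitive c d u f"
proof -
  have "u x = u c + integral {c..x} f" if "x \<in> {c..d}" for x
    using L1_primitive_subinterval(2)[OF assms(1), of c x] assms(2-) that by auto
  then show ?thesis
    using L1_primitive_subinterval(1)[OF assms] unfolding L1_primitive_def by blast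
qed

lemma L1_primitive_combine:
  assumes "L1_primitive a c u f" "L1_primitive c b u f" "a \<le> c" "c \<le> b"
  shows "L1_primitive a b u f"
proof -
  note f = L1_primitiveD(1)[OF assms(1)] L1_primitiveD(1)[OF assms(2)]
  then have fab: "f absolutely_integrable_on {a..b}"
    using set_integrable_Un[OF f] assms(3,4) by (simp add: ivl_disj_un_two_touch)
  have "u x = u a + integral {a..x} f" if x: "x \<in> {a..b}" for x
  proof (cases "x \<le> c")
    case True
    then show ?thesis using L1_primitiveD(3)[OF assms(1), of x] x by simp
  next
    case False
    have "integral {a..c} f + integral {c..x} f = integral {a..x} f"
      using False x assms(3) absolutely_integrable_on_subinterval[OF fab, of a x]
      by (intro Henstock_Kurzweil_Integration.integral_combine)
        (auto dest: set_lebesgue_integral_eq_integral(1))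
    then show ?thesis
      using L1_primitiveD(3)[OF assms(1), of c] L1_primitiveD(3)[OF assms(2), of x] assms(3) False x by simp
  qed
  with fab show ?thesis unfolding L1_primitive_def by blast
qed

text \<open>Differences of the vanishing integrals show that the integral of \<open>f\<close> over
  every interval is 0. The sets with zero integral are closed under complements and countable
  disjoint unions, so all Borel sets are among them, and a density with this property vanishes
  almost everywhere.\<close>

lemma L1_primitive_zero_AE:
  fixes f :: "real \<Rightarrow> real"
  assumes f: "f absolutely_integrable_on {a..b}"
    and zero: "\<And>x. x \<in> {a..b} \<Longrightarrow> integral {a..x} f = 0"
  shows "AE x in lebesgue. x \<in> {a..b} \<longrightarrow> f x = 0"
proof -
  define F where "F x = indicator {a..b} x * f x" for x
  have F: "integrable lebesgue F" using f by (simp add: F_def[abs_def] set_integrable_def)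
  then have "F \<in> borel_measurable (completion lborel)" by auto
  \<comment> \<open>The induction over sets below runs through the Borel sets, whereas
    \<open>F\<close> is only Lebesgue measurable; hence the passage to a Borel version.\<close>
  then obtain F' where F'm: "F' \<in> borel_measurable lborel" and FF': "AE x in lborel. F x = F' x"
    using completion_ex_borel_measurable_real by blast
  have FF'c: "AE x in lebesgue. F x = F' x" using FF' by (rule AE_completion)
  have "integrable lebesgue F'"
    using F FF'c F'm by (subst integrable_cong_AE[of F' _ F]) (auto intro: measurable_completion)
  then have F'i: "integrable lborel F'" using F'm by (simp add: integrable_completion)
  have F'lm: "F' \<in> borel_measurable lebesgue" using F'm by (simp add: measurable_completion)
  have Fint: "(LINT x:A|lborel. F' x) = (LINT x:A|lebesgue. F x)" if A: "A \<in> sets borel" for A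
  proof -
    have Al: "A \<in> sets lebesgue" using A by simp
    have "(LINT x:A|lborel. F' x) = (LINT x:A|lebesgue. F' x)"
      unfolding set_lebesgue_integral_def
      by (rule integral_completion[symmetric]) (use F'm A in measurable)
    also have "\<dots> = (LINT x:A|lebesgue. F x)"
      unfolding set_lebesgue_integral_def
    proof (rule integral_cong_AE)
      show "(\<lambda>x. indicator A x *\<^sub>R F' x) \<in> borel_measurable lebesgue"
        using F'lm Al by (intro borel_measurable_scaleR borel_measurable_indicator)
      show "(\<lambda>x. indicator A x *\<^sub>R F x) \<in> borel_measurable lebesgue"
        using F Al by (intro borel_measurable_scaleR borel_measurable_indicator) auto
      show "AE x in lebesgue. indicator A x *\<^sub>R F' x = indicator A x *\<^sub>R F x"
        using FF'c by eventually_elim simp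
    qed
    finally show ?thesis .
  qed
  have ivl: "(LINT x:{c..d}|lborel. F' x) = 0" for c d
  proof -
    have "F absolutely_integrable_on {c..d}"
      unfolding set_integrable_def by (rule integrable_mult_indicator[OF _ F]) auto
    then have "(LINT x:{c..d}|lborel. F' x) = integral {c..d} F"
      using Fint set_lebesgue_integral_eq_integral(2) by simp
    also have "\<dots> = integral ({a..b} \<inter> {c..d}) f"
      unfolding integral_restrict_Int[symmetric]
      by (intro integral_cong) (auto simp: F_def)
    also have "\<dots> = 0"
    proof (cases "max c a \<le> min d b")
      case True
      have "{a..b} \<inter> {c..d} = {max c a..min d b}" by auto
      moreover have "integral {a..max c a} f + integral {max c a..min d b} f = integral {a..min d b} f"
        using True absolutely_integrable_on_subinterval[OF f, of a "min d b"]
        by (intro Henstock_Kurzweil_Integration.integral_combine)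
          (auto dest: set_lebesgue_integral_eq_integral(1))
      ultimately show ?thesis using zero True by auto
    next
      case False
      then have "{a..b} \<inter> {c..d} = {}" by auto
      then show ?thesis by simp
    qed
    finally show ?thesis .
  qed
  \<comment> \<open>The complements in the induction are taken in the whole line, so its integral
    has to vanish as well. It equals the integral over \<open>{a..b}\<close>, outside which
    \<open>F\<close> is 0.\<close>
  have total: "(LINT x:UNIV|lborel. F' x) = 0"
  proof -
    have "(LINT x:UNIV|lborel. F' x) = (LINT x:{a..b}|lebesgue. F x)"
      using Fint[of UNIV] unfolding set_lebesgue_integral_def
      by (simp, intro Bochner_Integration.integral_cong) (auto simp: F_def indicator_def)
    then show ?thesis using Fint ivl by simp
  qed
  have int_A: "set_integrable lborel A F'" if "A \<in> sets borel" for A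
    unfolding set_integrable_def using that F'i by (intro integrable_mult_indicator) auto
  have "(LINT x:A|lborel. F' x) = 0" if "A \<in> sets lborel" for A
  proof -
    \<comment> \<open>With \<open>d < c\<close> permitted the empty set is included, which makes
      this generator stable under intersection.\<close>
    let ?E = "range (\<lambda>(c, d). {c..d::real})"
    have A: "A \<in> sigma_sets UNIV ?E"
      using that by (simp add: borel_eq_atLeastAtMost sets_lborel)
    have E: "Int_stable ?E" "?E \<subseteq> Pow UNIV" by (auto simp: Int_stable_def)
    show ?thesis
      using E A
    proof (induction A rule: sigma_sets_induct_disjoint)
      case (basic A)
      then show ?case using ivl by auto
    next
      case (compl A)
      have "A \<in> sets borel" using compl by (simp add: borel_eq_atLeastAtMost)
      then have "(LINT x:UNIV|lborel. F' x) = (LINT x:A|lborel. F' x) + (LINT x:UNIV - A|lborel. F' x)"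
        using int_A set_integral_Un[of A "UNIV - A" lborel F'] by simp
      then show ?case using compl total by simp
    next
      case (union A)
      have "range A \<subseteq> sets borel" using union(2) by (simp add: borel_eq_atLeastAtMost)
      then have "A i \<in> sets borel" for i by auto
      then have "(LINT x:(\<Union>i. A i)|lborel. F' x) = (\<Sum>i. LINT x:A i|lborel. F' x)"
        using union(1) int_A[of "\<Union>i. A i"]
        by (intro lebesgue_integral_countable_add) (auto simp: disjoint_family_on_def)
      then show ?case using union by simp
    qed (simp add: set_lebesgue_integral_def)
  qed
  then have "AE x in lborel. F' x = 0"
    using F'i by (intro sigma_finite_measure.density_zero[OF sigma_finite_lborel])
  then have "AE x in lebesgue. F' x = 0" by (rule AE_completion)
  with FF'c show ?thesis by eventually_elim (auto simp: F_def)
qed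

subsection \<open>Weak derivatives\<close>

text \<open>Integration by parts: the product rule gives a density of \<open>u x * \<psi> x\<close>,
  and this product vanishes at 0 and 1 because the support of \<psi> lies inside the open
  interval.\<close>

lemma has_L1_weak_derivative_on_primitive:
  assumes u: "L1_primitive 0 1 u f"
  shows "has_L1_weak_derivative_on u f {0<..<1}"
  unfolding has_L1_weak_derivative_on_def
proof (intro conjI allI impI)
  have ua: "u absolutely_integrable_on {0..1}"
    by (rule absolutely_integrable_continuous_real[OF L1_primitive_continuous[OF u]])
  have sub: "g absolutely_integrable_on {0<..<1}" if "g absolutely_integrable_on {0..1}"
    for g :: "real \<Rightarrow> real"
    by (rule set_integrable_subset[OF that]) auto
  show "u absolutely_integrable_on {0<..<1}" "f absolutely_integrable_on {0<..<1}"
    using sub ua L1_primitiveD(1)[OF u] by auto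
  fix \<psi> assume \<psi>: "test_function_on {0<..<1} \<psi>"
  obtain D where D: "\<And>x. (\<psi> has_real_derivative D x) (at x)" and cD: "continuous_on UNIV D"
    using \<psi> by (auto simp: test_function_on_def C1_differentiable_on_def
        has_real_derivative_iff_has_vector_derivative)
  have dD: "deriv \<psi> = D" using D by (auto intro: DERIV_imp_deriv)
  have P: "L1_primitive 0 1 \<psi> D"
    by (rule L1_primitive_C1) (auto intro: has_field_derivative_at_within D continuous_on_subset[OF cD])
  have "\<psi> x = 0" if "x \<notin> {0<..<1}" for x
    using \<psi> that closure_subset[of "{x. \<psi> x \<noteq> 0}"] by (auto simp: test_function_on_def)
  then have z: "\<psi> 0 = 0" "\<psi> 1 = 0" by simp_all
  have uD: "(\<lambda>x. u x * D x) absolutely_integrable_on {0..1}"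
    by (rule absolutely_integrable_continuous_mult(1)[OF L1_primitive_continuous[OF u] L1_primitiveD(1)[OF P]])
  have fp: "(\<lambda>x. f x * \<psi> x) absolutely_integrable_on {0..1}"
    by (rule absolutely_integrable_continuous_mult(2)[OF L1_primitive_continuous[OF P] L1_primitiveD(1)[OF u]])
  have "0 = integral {0..1} (\<lambda>x. f x * \<psi> x + u x * D x)"
    using L1_primitiveD(3)[OF L1_primitive_mult[OF u P], of 1] z by simp
  also have "\<dots> = integral {0..1} (\<lambda>x. f x * \<psi> x) + integral {0..1} (\<lambda>x. u x * D x)"
    by (intro integral_add set_lebesgue_integral_eq_integral(1) fp uD)
  finally show "(LINT x:{0<..<1}|lebesgue. u x * deriv \<psi> x) = - (LINT x:{0<..<1}|lebesgue. f x * \<psi> x)"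
    by (simp add: dD set_lebesgue_integral_eq_integral(2)[OF sub[OF uD]]
        set_lebesgue_integral_eq_integral(2)[OF sub[OF fp]] integral_open_interval_real)
qed

text \<open>The test function is the primitive of \<open>(v - c) \<eta>\<close>, where \<open>\<eta>\<close> is a bump function and \<open>c\<close>
  the \<open>\<eta>\<close>-average of \<open>v\<close>; testing with it yields \<open>\<integral>(v - c)\<^sup>2 \<eta> = 0\<close>.\<close>

lemma constant_on_if_test_derivatives_vanish:
  fixes v :: "real \<Rightarrow> real"
  assumes v: "continuous_on {0..1} v"
    and zero: "\<And>\<psi>. test_function_on {0<..<1} \<psi> \<Longrightarrow> integral {0..1} (\<lambda>x. v x * deriv \<psi> x) = 0"
    and x: "x \<in> {0<..<1}" and y: "y \<in> {0<..<1}"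
  shows "v x = v y"
proof -
  \<comment> \<open>The interval from \<open>a\<close> to \<open>b\<close> contains \<open>x\<close>
    and \<open>y\<close> in its interior and stays away from 0 and 1, so functions supported in it
    are compactly supported in the open unit interval.\<close>
  define a where "a = min x y / 2"
  define b where "b = (1 + max x y) / 2"
  have ab: "0 < a" "b < 1" "a < x" "a < y" "x < b" "y < b" "a < b"
    using x y by (auto simp: a_def b_def)
  define \<eta> where "\<eta> t = max 0 ((t - a) * (b - t))" for t
  \<comment> \<open>Continuing \<open>v\<close> by its boundary values makes \<open>w\<close>
    continuous on the whole line, as needed for a test function that is C1 on
    \<open>UNIV\<close>.\<close>
  define V where "V t = v (max 0 (min 1 t))" for t
  have \<eta>c: "continuous_on S \<eta>" for S unfolding \<eta>_def by (intro continuous_intros)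
  have \<eta>0: "\<eta> t \<ge> 0" for t by (simp add: \<eta>_def)
  have \<eta>pos: "\<eta> t > 0" if "a < t" "t < b" for t using that by (simp add: \<eta>_def)
  have \<eta>z: "\<eta> t = 0" if "t \<le> a \<or> b \<le> t" for t
    using that ab unfolding \<eta>_def by (intro max_absorb1) (auto simp: mult_le_0_iff)
  have Vc: "continuous_on S V" for S unfolding V_def
    by (rule continuous_on_compose2[OF v]) (auto intro!: continuous_intros)
  have Vv: "V t = v t" if "t \<in> {0..1}" for t using that by (simp add: V_def)
  define N where "N = integral {0..1} \<eta>"
  have "N \<noteq> 0"
  proof
    assume "N = 0"
    then have "\<forall>t\<in>{0..1}. \<eta> t = 0"
      unfolding N_def by (subst integral_eq_0_iff[symmetric]) (simp_all add: \<eta>c \<eta>0)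
    then show False using \<eta>pos[of x] ab by auto
  qed
  \<comment> \<open>This value makes the integral of \<open>w\<close> vanish, so that its primitive
    \<psi> returns to 0 at \<open>b\<close> and remains 0 from there on.\<close>
  define c where "c = integral {0..1} (\<lambda>t. V t * \<eta> t) / N"
  define w where "w t = (V t - c) * \<eta> t" for t
  have wc: "continuous_on S w" for S unfolding w_def by (intro continuous_intros \<eta>c Vc)
  have wi: "w integrable_on {p..q}" for p q by (intro integrable_continuous_interval wc)
  have wz: "w t = 0" if "t \<le> a \<or> b \<le> t" for t using \<eta>z[OF that] by (simp add: w_def)
  have wint: "integral {0..1} w = 0"
  proof -
    have "integral {0..1} w = integral {0..1} (\<lambda>t. V t * \<eta> t - c * \<eta> t)"
      by (simp add: w_def[abs_def] algebra_simps)
    also have "\<dots> = integral {0..1} (\<lambda>t. V t * \<eta> t) - integral {0..1} (\<lambda>t. c * \<eta> t)"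
      by (intro integral_diff integrable_continuous_interval continuous_intros \<eta>c Vc)
    also have "\<dots> = 0" using \<open>N \<noteq> 0\<close> by (simp add: c_def N_def)
    finally show ?thesis .
  qed
  define \<psi> where "\<psi> t = integral {0..t} w" for t
  have \<psi>z: "\<psi> t = 0" if "t \<le> a" for t
    using that unfolding \<psi>_def by (subst integral_cong[of _ w "\<lambda>_. 0"]) (auto intro: wz)
  have \<psi>b: "\<psi> t = \<psi> b" if "b \<le> t" for t
  proof -
    have "integral {0..b} w + integral {b..t} w = integral {0..t} w"
      using that ab wi by (intro Henstock_Kurzweil_Integration.integral_combine) auto
    moreover have "integral {b..t} w = 0"
      by (subst integral_cong[of _ w "\<lambda>_. 0"]) (auto intro: wz)
    ultimately show ?thesis by (simp add: \<psi>_def)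
  qed
  have D: "(\<psi> has_real_derivative w t) (at t)" for t
  \<comment> \<open>Left of \<open>a\<close> the function \<psi> is locally 0; for negative
    \<open>t\<close> the interval \<open>{0..t}\<close> is empty. Otherwise \<open>t\<close> is
    positive, thus interior to \<open>{0..t + 1}\<close>, and the one-sided fundamental theorem
    gives a two-sided derivative.\<close>
  proof (cases "t < a")
    case True
    have "(\<psi> has_real_derivative 0) (at t)"
      by (rule has_field_derivative_transform_within_open[where S = "{..<a}" and f = "\<lambda>_. 0"])
        (use True \<psi>z in auto)
    then show ?thesis using wz[of t] True by simp
  next
    case False
    then have "t \<in> {0<..<t + 1}" using ab by simp
    moreover have "(\<psi> has_real_derivative w t) (at t within {0..t + 1})"
      unfolding \<psi>_def using calculation by (intro integral_has_real_derivative wc) simp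
    ultimately show ?thesis by (simp add: at_within_Icc_at)
  qed
  then have dw: "deriv \<psi> = w" by (auto intro: DERIV_imp_deriv)
  have "{t. \<psi> t \<noteq> 0} \<subseteq> {a..b}"
  proof
    fix t assume t: "t \<in> {t. \<psi> t \<noteq> 0}"
    have "\<psi> b = 0" using \<psi>b[of 1] wint ab by (simp add: \<psi>_def)
    then show "t \<in> {a..b}" using \<psi>z[of t] \<psi>b[of t] t by (cases "t \<le> a"; cases "b \<le> t") auto
  qed
  then have cl: "closure {t. \<psi> t \<noteq> 0} \<subseteq> {a..b}" by (rule closure_minimal) simp
  have "test_function_on {0<..<1} \<psi>"
    unfolding test_function_on_def
  proof (intro conjI)
    show "\<psi> C1_differentiable_on UNIV"
      unfolding C1_differentiable_on_def using D wc
      by (auto simp: has_real_derivative_iff_has_vector_derivative)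
    show "compact (closure {t. \<psi> t \<noteq> 0})"
      using bounded_subset[OF bounded_closed_interval cl] by (simp add: compact_eq_bounded_closed)
    show "closure {t. \<psi> t \<noteq> 0} \<subseteq> {0<..<1}" using cl ab by force
  qed
  from zero[OF this] have "integral {0..1} (\<lambda>t. v t * w t) = 0" unfolding dw .
  moreover have "integral {0..1} (\<lambda>t. v t * w t) = integral {0..1} (\<lambda>t. V t * w t)"
    by (intro integral_cong) (simp add: Vv)
  ultimately have "integral {0..1} (\<lambda>t. V t * w t) = 0" by simp
  \<comment> \<open>Subtracting \<open>c\<close> times the integral of \<open>w\<close>, which is 0,
    completes the integrand to the square \<open>(V t - c)\<^sup>2 * \<eta> t\<close>.\<close>
  moreover have "integral {0..1} (\<lambda>t. V t * w t - c * w t) =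
      integral {0..1} (\<lambda>t. V t * w t) - integral {0..1} (\<lambda>t. c * w t)"
    by (intro integral_diff integrable_continuous_interval continuous_intros wc Vc)
  ultimately have "integral {0..1} (\<lambda>t. V t * w t - c * w t) = 0" using wint by simp
  moreover have "V t * w t - c * w t = (V t - c)\<^sup>2 * \<eta> t" for t
    by (simp add: w_def power2_eq_square algebra_simps)
  ultimately have "integral {0..1} (\<lambda>t. (V t - c)\<^sup>2 * \<eta> t) = 0" by simp
  moreover have "continuous_on {0..1} (\<lambda>t. (V t - c)\<^sup>2 * \<eta> t)"
    by (intro continuous_intros \<eta>c Vc)
  ultimately have "\<forall>t\<in>{0..1}. (V t - c)\<^sup>2 * \<eta> t = 0"
    by (subst integral_eq_0_iff[symmetric]) (simp_all add: \<eta>0)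
  then have V: "V t = c" if "a < t" "t < b" for t
    using \<eta>pos[OF that] ab that by force
  have "V x = v x" "V y = v y" using x y by (auto intro!: Vv)
  with V[of x] V[of y] ab show ?thesis by simp
qed

text \<open>The du Bois-Reymond argument: \<open>r\<close> and the primitive \<open>p\<close> of
  \<open>g\<close> have the same weak derivative, so their difference is orthogonal to all
  derivatives of test functions and hence constant.\<close>

lemma L1_primitive_weak_derivative:
  assumes r: "continuous_on {0..1} r" and g: "has_L1_weak_derivative_on r g {0<..<1}"
  shows "L1_primitive 0 1 r g"
proof -
  have "g absolutely_integrable_on {0<..<1}" using g by (simp add: has_L1_weak_derivative_on_def)
  then have ga: "g absolutely_integrable_on {0..1}"
  proof (rule absolutely_integrable_spike_set)
    show "negligible {x \<in> {0<..<1} - {0..1}. g x \<noteq> 0}" by (rule negligible_subset[of "{}"]) auto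
    show "negligible {x \<in> {0..1} - {0<..<1}. g x \<noteq> 0}"
      by (rule negligible_subset[of "{0, 1}"]) auto
  qed
  define p where "p x = integral {0..x} g" for x
  have p: "L1_primitive 0 1 p g" using ga by (simp add: L1_primitive_def p_def)
  define v where "v x = r x - p x" for x
  have vc: "continuous_on {0..1} v" unfolding v_def
    by (intro continuous_intros r L1_primitive_continuous[OF p])
  have const: "v x = v y" if "x \<in> {0<..<1}" "y \<in> {0<..<1}" for x y
  proof (rule constant_on_if_test_derivatives_vanish[OF vc _ that])
    fix \<psi> assume \<psi>: "test_function_on {0<..<1} \<psi>"
    obtain D where D: "\<And>x. (\<psi> has_real_derivative D x) (at x)" and cD: "continuous_on UNIV D"
      using \<psi> by (auto simp: test_function_on_def C1_differentiable_on_def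
          has_real_derivative_iff_has_vector_derivative)
    have dD: "deriv \<psi> = D" using D by (auto intro: DERIV_imp_deriv)
    note cD' = continuous_on_subset[OF cD subset_UNIV]
    have wd: "(LINT x:{0<..<1}|lebesgue. u x * D x) = - (LINT x:{0<..<1}|lebesgue. g x * \<psi> x)"
      if "has_L1_weak_derivative_on u g {0<..<1}" for u
      using that \<psi> unfolding has_L1_weak_derivative_on_def dD[symmetric] by blast
    have "(LINT x:{0<..<1}|lebesgue. r x * D x) = (LINT x:{0<..<1}|lebesgue. p x * D x)"
      unfolding wd[OF g] wd[OF has_L1_weak_derivative_on_primitive[OF p]] ..
    moreover have eq: "(LINT x:{0<..<1}|lebesgue. u x * D x) = integral {0..1} (\<lambda>x. u x * D x)"
      if u: "continuous_on {0..1} u" for u :: "real \<Rightarrow> real"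
    proof -
      have "(\<lambda>x. u x * D x) absolutely_integrable_on {0<..<1}"
        by (rule set_integrable_subset[OF absolutely_integrable_continuous_real[of 0 1]])
          (auto intro!: continuous_intros u cD')
      then show ?thesis by (simp add: set_lebesgue_integral_eq_integral(2) integral_open_interval_real)
    qed
    ultimately have "integral {0..1} (\<lambda>x. r x * D x) = integral {0..1} (\<lambda>x. p x * D x)"
      using r L1_primitive_continuous[OF p] by simp
    moreover have "integral {0..1} (\<lambda>x. r x * D x - p x * D x) =
        integral {0..1} (\<lambda>x. r x * D x) - integral {0..1} (\<lambda>x. p x * D x)"
      by (intro integral_diff integrable_continuous_interval continuous_intros r cD' L1_primitive_continuous[OF p])
    ultimately show "integral {0..1} (\<lambda>x. v x * deriv \<psi> x) = 0"
      by (simp add: v_def dD left_diff_distrib)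
  qed
  \<comment> \<open>Continuity carries the constancy over to the endpoints; the value at 0 is the
    constant of integration.\<close>
  have half: "v x = v (1/2)" if "x \<in> {0..1}" for x
  proof (rule continuous_constant_on_closure[where S = "{0<..<1}" and f = v])
    show "continuous_on (closure {0<..<1}) v" using vc by simp
    show "x \<in> closure {0<..<1}" using that by simp
  qed (rule const; simp)
  have "r x = r 0 + p x" if "x \<in> {0..1}" for x
  proof -
    have "v x = v 0" using half[OF that] half[of 0, symmetric] by (rule trans) simp
    then show ?thesis by (simp add: v_def p_def)
  qed
  then show ?thesis using ga unfolding L1_primitive_def p_def by blast
qed

lemma L1_primitive_unique_AE:
  assumes f: "L1_primitive a b u f" and g: "L1_primitive a b u g"
  shows "AE x in lebesgue. x \<in> {a..b} \<longrightarrow> f x = g x"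
proof -
  note d = L1_primitive_diff[OF f g]
  have "AE x in lebesgue. x \<in> {a..b} \<longrightarrow> f x - g x = 0"
  proof (rule L1_primitive_zero_AE[OF L1_primitiveD(1)[OF d]])
    fix x assume "x \<in> {a..b}"
    from L1_primitiveD(3)[OF d this] show "integral {a..x} (\<lambda>x. f x - g x) = 0" by simp
  qed
  then show ?thesis by eventually_elim simp
qed

lemma W11_primitive:
  assumes "r \<in> W11"
  shows "L1_primitive 0 1 r (weak_deriv r)"
proof -
  have "\<exists>g. has_L1_weak_derivative_on r g {0<..<1}" using assms by (simp add: W11_def)
  then have "has_L1_weak_derivative_on r (weak_deriv r) {0<..<1}"
    unfolding weak_deriv_def by (rule someI_ex)
  then show ?thesis using assms by (intro L1_primitive_weak_derivative) (auto simp: W11_def)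
qed

text \<open>\<open>weak_deriv\<close> is a choice among all weak derivatives, so a concretely given
  density can be recovered from it only up to a null set.\<close>

lemma primitive_W11:
  assumes "L1_primitive 0 1 r g"
  shows "r \<in> W11" and "AE x in lebesgue. x \<in> {0<..<1} \<longrightarrow> weak_deriv r x = g x"
proof -
  show r: "r \<in> W11"
    using has_L1_weak_derivative_on_primitive[OF assms] L1_primitive_continuous[OF assms]
    by (auto simp: W11_def)
  show "AE x in lebesgue. x \<in> {0<..<1} \<longrightarrow> weak_deriv r x = g x"
    using L1_primitive_unique_AE[OF W11_primitive[OF r] assms] by eventually_elim simp
qed

subsection \<open>The competitor\<close>

lemma strictly_convex_on_imp_convex_on:
  assumes "strictly_convex_on S f"
  shows "convex_on S f"
proof (rule convex_onI)
  show "convex S" using assms by (simp add: strictly_convex_on_def)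
  fix t x y :: real assume *: "t > 0" "t < 1" "x \<in> S" "y \<in> S"
  show "f ((1 - t) *\<^sub>R x + t *\<^sub>R y) \<le> (1 - t) * f x + t * f y"
  proof (cases "x = y")
    case True
    then show ?thesis by (simp add: algebra_simps)
  next
    case False
    then show ?thesis using assms * by (auto simp: strictly_convex_on_def intro: less_imp_le)
  qed
qed

lemma convex_on_pos_tangent:
  assumes "convex_on {0<..} f" "f differentiable_on {0<..}" "x > 0" "y > (0::real)"
  shows "f x + deriv f x * (y - x) \<le> f y"
proof -
  have "f differentiable (at x)"
    using assms(2,3) differentiable_on_eq_differentiable_at[of "{0<..}" f] by simp
  then have "(f has_real_derivative deriv f x) (at x)"
    by (simp add: DERIV_deriv_iff_real_differentiable)
  then have "f y - f x \<ge> deriv f x * (y - x)"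
    using assms by (intro convex_on_imp_above_tangent[where A = "{0<..}"])
      (auto simp: interior_open at_within_open[of x "{0<..}"])
  then show ?thesis by simp
qed

text \<open>If \<open>h x\<close> were equal to \<open>h d0\<close>, strict convexity would push the
  midpoint below the minimum. So \<open>h d0 < h x\<close>, and the tangent at \<open>x\<close>,
  which lies below the graph at \<open>d0\<close>, must descend.\<close>

lemma deriv_neg_left_of_strict_convex_minimum:
  assumes h: "strictly_convex_on {0<..} h" "h differentiable_on {0<..}"
    and d0: "is_arg_min h (\<lambda>d. d > 0) d0" and x: "0 < x" "x < d0"
  shows "deriv h x < 0"
proof -
  have min: "h d0 \<le> h y" if "y > 0" for y
    using d0 that by (force simp: is_arg_min_def)
  have "h ((1 - 1/2) * x + 1/2 * d0) < (1 - 1/2) * h x + 1/2 * h d0"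
    using h(1)[unfolded strictly_convex_on_def, THEN conjunct2, rule_format, of x d0 "1/2"] x by auto
  moreover have "h d0 \<le> h ((1 - 1/2) * x + 1/2 * d0)" using x by (intro min) simp
  ultimately have "h d0 < h x" by simp
  moreover have "h x + deriv h x * (d0 - x) \<le> h d0"
    using x by (intro convex_on_pos_tangent strictly_convex_on_imp_convex_on h) auto
  ultimately have "deriv h x * (d0 - x) < 0" by linarith
  then show ?thesis using x by (simp add: mult_less_0_iff)
qed

lemma L1_primitive_cong:
  assumes "L1_primitive a b u f" and "\<And>x. x \<in> {a..b} \<Longrightarrow> v x = u x"
    and "negligible N" "\<And>x. x \<in> {a..b} - N \<Longrightarrow> g x = f x"
  shows "L1_primitive a b v g"
proof -
  have "g absolutely_integrable_on {a..b}"
    using absolutely_integrable_spike[OF L1_primitiveD(1)[OF assms(1)] assms(3,4)] .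
  moreover have "v x = v a + integral {a..x} g" if "x \<in> {a..b}" for x
  proof -
    have "integral {a..x} g = integral {a..x} f"
      using assms(3) by (rule integral_spike) (use assms(4) that in auto)
    then show ?thesis using L1_primitiveD(3)[OF assms(1) that] assms(2)[of x] assms(2)[of a] that by simp
  qed
  ultimately show ?thesis unfolding L1_primitive_def by blast
qed

text \<open>Applied to a minimizer, this gives the lower bound \<open>r 0\<close> for
  \<open>r\<close>, the source of positivity and of finite potential energy. The sign is demanded on
  the open interval only, as in the admissibility condition.\<close>

lemma L1_primitive_ge_initial:
  assumes u: "L1_primitive a b u f" and f: "AE x in lebesgue. x \<in> {a<..<b} \<longrightarrow> f x \<ge> 0"
    and x: "x \<in> {a..b}"
  shows "u a \<le> u x"
proof -
  have "f absolutely_integrable_on {a..x}"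
    using L1_primitive_subinterval(1)[OF u, of a x] x by auto
  then have "f absolutely_integrable_on {a<..<x}" by (rule set_integrable_subset) auto
  then have "integral {a..x} f = (LINT t:{a<..<x}|lebesgue. f t)"
    by (simp add: integral_open_interval_real set_lebesgue_integral_eq_integral(2))
  also have "\<dots> \<ge> 0" unfolding set_lebesgue_integral_def
  proof (rule integral_nonneg_AE)
    show "AE t in lebesgue. 0 \<le> indicat_real {a<..<x} t *\<^sub>R f t"
      using f by eventually_elim (use x in \<open>auto simp: indicator_def\<close>)
  qed
  finally show ?thesis using L1_primitiveD(3)[OF u x] by simp
qed

text \<open>Here \<open>p\<close> and \<open>k\<close> stand for the tangent slopes \<open>\<phi>'(lam)\<close> and \<open>h'(lam\<^sup>3)\<close>.\<close>

lemma tangent_remainder_integral_pos: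
  fixes r g \<alpha> \<alpha>' :: "real \<Rightarrow> real"
  assumes r: "L1_primitive 0 c r g" and \<alpha>: "L1_primitive 0 c \<alpha> \<alpha>'"
    and \<alpha>': "\<And>x. x \<in> {0..c} \<Longrightarrow> \<alpha>' x \<le> 0" and c: "c \<ge> 0" "r c = lam * c"
    and above: "\<And>x. x \<in> {0..c} \<Longrightarrow> lam * x \<le> r x"
    and p: "p \<ge> 0" and k: "k < 0" and r0: "r 0 > 0"
  defines "L \<equiv> \<lambda>x. p * (\<alpha> x * ((g x - lam) * x\<^sup>2 + 2 * x * (r x - lam * x)))
                    + k * ((r x)\<^sup>2 * g x - lam ^ 3 * x\<^sup>2)"
  shows "L absolutely_integrable_on {0..c}" and "integral {0..c} L > 0"
proof -
  \<comment> \<open>\<open>L1\<close> is \<alpha> times the density of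
    \<open>x\<^sup>2 * u x\<close>, and \<open>L2\<close> is one third of the density of
    \<open>r x ^ 3 - lam ^ 3 * x ^ 3\<close>.\<close>
  define L1 where "L1 x = \<alpha> x * ((g x - lam) * x\<^sup>2 + 2 * x * (r x - lam * x))" for x
  define L2 where "L2 x = (r x)\<^sup>2 * g x - lam ^ 3 * x\<^sup>2" for x
  define u where "u x = r x - lam * x" for x
  have id: "L1_primitive 0 c (\<lambda>x. lam * x) (\<lambda>_. lam)"
    by (rule L1_primitive_C1) (auto intro!: derivative_eq_intros)
  have sq: "L1_primitive 0 c (\<lambda>x. x\<^sup>2) (\<lambda>x. 2 * x)"
    by (rule L1_primitive_C1) (auto intro!: derivative_eq_intros continuous_intros)
  have cube: "L1_primitive 0 c (\<lambda>x. lam ^ 3 * x ^ 3) (\<lambda>x. lam ^ 3 * (3 * x\<^sup>2))"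
    by (rule L1_primitive_C1) (auto intro!: derivative_eq_intros continuous_intros)
  have u: "L1_primitive 0 c u (\<lambda>x. g x - lam)"
    using L1_primitive_diff[OF r id] by (simp add: u_def[abs_def])
  note su = L1_primitive_mult[OF sq u]
  note w = L1_primitive_mult[OF \<alpha> su]
  have ca: "continuous_on {0..c} \<alpha>" by (rule L1_primitive_continuous[OF \<alpha>])
  have csu: "continuous_on {0..c} (\<lambda>x. x\<^sup>2 * u x)" by (rule L1_primitive_continuous[OF su])
  have i1: "(\<lambda>x. \<alpha>' x * (x\<^sup>2 * u x)) absolutely_integrable_on {0..c}"
    by (rule absolutely_integrable_continuous_mult(2)[OF csu L1_primitiveD(1)[OF \<alpha>]])
  have "(\<lambda>x. \<alpha> x * (2 * x * u x + x\<^sup>2 * (g x - lam))) absolutely_integrable_on {0..c}"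
    by (rule absolutely_integrable_continuous_mult(1)[OF ca L1_primitiveD(1)[OF su]])
  moreover have L1eq: "L1 = (\<lambda>x. \<alpha> x * (2 * x * u x + x\<^sup>2 * (g x - lam)))"
    by (simp add: L1_def u_def fun_eq_iff algebra_simps)
  ultimately have L1i: "L1 absolutely_integrable_on {0..c}" by simp
  \<comment> \<open>Integration by parts without boundary terms: \<open>x\<^sup>2 * u x\<close>
    vanishes at 0 by its first factor and at \<open>c\<close> because
    \<open>r c = lam * c\<close>.\<close>
  have "0 = integral {0..c} (\<lambda>x. \<alpha>' x * (x\<^sup>2 * u x) + L1 x)"
    using L1_primitiveD(3)[OF w, of c] c by (simp add: u_def L1eq)
  also have "\<dots> = integral {0..c} (\<lambda>x. \<alpha>' x * (x\<^sup>2 * u x)) + integral {0..c} L1"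
    by (intro integral_add set_lebesgue_integral_eq_integral(1) i1 L1i)
  finally have "integral {0..c} L1 = - integral {0..c} (\<lambda>x. \<alpha>' x * (x\<^sup>2 * u x))" by simp
  moreover have "integral {0..c} (\<lambda>x. \<alpha>' x * (x\<^sup>2 * u x)) \<le> integral {0..c} (\<lambda>x. 0)"
    using \<alpha>' above
    by (intro integral_le set_lebesgue_integral_eq_integral(1)[OF i1] integrable_0)
      (auto simp: u_def mult_nonpos_nonneg)
  ultimately have L1pos: "integral {0..c} L1 \<ge> 0" by simp
  note d = L1_primitive_diff[OF L1_primitive_mult[OF L1_primitive_mult[OF r r] r] cube]
  have deq: "(\<lambda>x. (g x * r x + r x * g x) * r x + r x * r x * g x - lam ^ 3 * (3 * x\<^sup>2)) = (\<lambda>x. 3 * L2 x)"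
    by (simp add: L2_def fun_eq_iff power2_eq_square algebra_simps)
  have "(\<lambda>x. 3 * L2 x) absolutely_integrable_on {0..c}"
    using L1_primitiveD(1)[OF d] unfolding deq .
  then have L2i: "L2 absolutely_integrable_on {0..c}" by simp
  \<comment> \<open>The two cubes agree at \<open>c\<close>, and at 0 only that of \<open>r\<close>
    survives. A positive \<open>r 0\<close> thus makes the energy gain strict.\<close>
  have "integral {0..c} (\<lambda>x. 3 * L2 x) = - (r 0 ^ 3)"
    using L1_primitiveD(3)[OF d, of c] c unfolding deq
    by (simp add: power3_eq_cube algebra_simps)
  moreover have "r 0 ^ 3 > 0" using r0 by simp
  ultimately have "integral {0..c} L2 < 0" unfolding integral_mult_right by linarith
  then have "k * integral {0..c} L2 > 0" using k by (simp add: mult_neg_neg)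
  moreover have "integral {0..c} L = p * integral {0..c} L1 + k * integral {0..c} L2"
  proof -
    have "integral {0..c} L = integral {0..c} (\<lambda>x. p * L1 x) + integral {0..c} (\<lambda>x. k * L2 x)"
      unfolding L_def L1_def[symmetric] L2_def[symmetric]
      by (intro integral_add integrable_on_mult_right set_lebesgue_integral_eq_integral(1) L1i L2i)
    then show ?thesis by simp
  qed
  ultimately show "integral {0..c} L > 0" using p L1pos by (simp add: add_nonneg_pos)
  show "L absolutely_integrable_on {0..c}"
    unfolding L_def L1_def[symmetric] L2_def[symmetric]
    by (intro set_integral_add set_integrable_mult_right L1i L2i)
qed

text \<open>The zeros of \<open>r x - lam * x\<close> in the unit interval form a compact set
  containing 1; \<open>c\<close> is its least element. A negative value before \<open>c\<close>
  would, by the intermediate value theorem, produce an earlier zero, as the difference is positive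
  at 0.\<close>

lemma first_crossing:
  fixes r :: "real \<Rightarrow> real"
  assumes r: "continuous_on {0..1} r" and "r 0 > 0" "r 1 = lam"
  obtains c where "0 < c" "c \<le> 1" "r c = lam * c" "\<And>x. x \<in> {0..c} \<Longrightarrow> lam * x \<le> r x"
proof -
  define S where "S = {x \<in> {0..1}. r x - lam * x = 0}"
  have cu: "continuous_on {0..1} (\<lambda>x. r x - lam * x)" by (intro continuous_intros r)
  have "closed S" unfolding S_def by (intro continuous_closed_preimage_constant cu) simp
  then have "compact S"
    by (auto simp: compact_eq_bounded_closed S_def intro: bounded_subset[OF bounded_closed_interval[of 0 1]])
  moreover have "1 \<in> S" using assms by (simp add: S_def)
  ultimately obtain c where c: "c \<in> S" "\<And>t. t \<in> S \<Longrightarrow> c \<le> t"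
    using compact_attains_inf[of S] by blast
  have "c \<noteq> 0" using c(1) \<open>r 0 > 0\<close> by (auto simp: S_def)
  moreover have "lam * x \<le> r x" if x: "x \<in> {0..c}" for x
  proof (rule ccontr)
    assume n: "\<not> lam * x \<le> r x"
    have "continuous_on {0..x} (\<lambda>x. r x - lam * x)"
      by (rule continuous_on_subset[OF cu]) (use x c(1) in \<open>auto simp: S_def\<close>)
    then obtain t where "0 \<le> t" "t \<le> x" "r t - lam * t = 0"
      using IVT2'[of "\<lambda>x. r x - lam * x" x 0 0] n x \<open>r 0 > 0\<close> by auto
    moreover have "t \<in> S" using calculation x c(1) by (auto simp: S_def)
    ultimately have "x = c" using c(2)[of t] x by auto
    then show False using n c(1) by (simp add: S_def)
  qed
  ultimately show thesis using that[of c] c(1) by (auto simp: S_def)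
qed

section \<open>Bounds for the mass and the potential energy\<close>

lemma mass_nonneg:
  assumes "\<And>R. R \<in> {0..1} \<Longrightarrow> 0 \<le> \<rho>0 R" "R \<in> {0..1}"
  shows "0 \<le> mass \<rho>0 R"
  unfolding mass_def set_lebesgue_integral_def
  by (intro mult_nonneg_nonneg Bochner_Integration.integral_nonneg)
    (use assms in \<open>auto simp: indicator_def\<close>)

lemma mass_le:
  assumes "\<And>R. R \<in> {0..1} \<Longrightarrow> 0 \<le> \<rho>0 R \<and> \<rho>0 R \<le> k1" "R \<in> {0..1}"
  shows "mass \<rho>0 R \<le> 4 * pi * k1"
proof -
  have "(LINT u|lebesgue. indicator {0..R} u *\<^sub>R (\<rho>0 u * u\<^sup>2)) \<le> (LINT u::real|lebesgue. indicator {0..1} u * k1)"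
  \<comment> \<open>This rule asks for an integrable, nonnegative majorant: a non-integrable
    integrand on the left would have the default integral 0.\<close>
  proof (rule integral_mono')
    show "integrable lebesgue (\<lambda>u::real. indicat_real {0..1} u * k1)"
      using lmeasurable_cbox[of "0::real" 1]
      by (intro integrable_mult_left integrable_real_indicator) (simp_all add: fmeasurable_def)
    have k1: "0 \<le> k1" using assms(1)[of 0] by simp
    fix u :: real
    show "0 \<le> indicat_real {0..1} u * k1" using k1 by simp
    show "indicat_real {0..R} u *\<^sub>R (\<rho>0 u * u\<^sup>2) \<le> indicat_real {0..1} u * k1"
    proof (cases "u \<in> {0..R}")
      case True
      then have "\<rho>0 u * u\<^sup>2 \<le> k1 * 1"
        using assms k1 by (intro mult_mono) (auto simp: power_le_one)
      then show ?thesis using True assms(2) by (simp add: indicator_def)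
    qed (use k1 in simp)
  qed
  also have "\<dots> = k1" by simp
  finally show ?thesis unfolding mass_def set_lebesgue_integral_def by (simp add: mult_left_mono)
qed

text \<open>Used with \<open>e = r 0\<close>: a cavity keeps the denominator away from 0. Finite
  potential energy of \<open>r\<close> keeps its total energy above minus infinity, so that a
  strictly smaller value is possible at all.\<close>

lemma I_pot_finite:
  assumes \<rho>0: "\<And>R. R \<in> {0..1} \<Longrightarrow> 0 \<le> \<rho>0 R \<and> \<rho>0 R \<le> k1"
    and e: "e > 0" "\<And>R. R \<in> {0..1} \<Longrightarrow> e \<le> r R"
  shows "I_pot \<rho>0 r < \<infinity>"
proof -
  have k1: "0 \<le> k1" using \<rho>0[of 0] by simp
  let ?K = "k1 * (4 * pi * k1 / e) * 1"
  have "I_pot \<rho>0 r \<le> (\<integral>\<^sup>+ R. ennreal ?K * indicator {0<..<1} R \<partial>(lebesgue :: real measure))"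
    unfolding I_pot_def
  proof (rule nn_integral_mono)
    fix R :: real
    show "ennreal (\<rho>0 R * (mass \<rho>0 R / r R) * R\<^sup>2) * indicator {0<..<1} R \<le> ennreal ?K * indicator {0<..<1} R"
    proof (cases "R \<in> {0<..<1}")
      case True
      have m: "0 \<le> mass \<rho>0 R" "mass \<rho>0 R \<le> 4 * pi * k1"
        using mass_nonneg[of \<rho>0 R] mass_le[of \<rho>0 k1 R] \<rho>0 True by auto
      have "mass \<rho>0 R / r R \<le> 4 * pi * k1 / e"
        using m e(1) e(2)[of R] True k1 by (intro frac_le) auto
      then have "\<rho>0 R * (mass \<rho>0 R / r R) * R\<^sup>2 \<le> ?K"
        using m e(1) e(2)[of R] True \<rho>0[of R] k1 by (intro mult_mono) (auto simp: power_le_one)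
      then show ?thesis using True by (simp add: ennreal_leI)
    qed simp
  qed
  also have "\<dots> < \<infinity>" by (simp add: nn_integral_cmult_indicator ennreal_mult_less_top)
  finally show ?thesis .
qed

lemma I_pot_antimono:
  assumes \<rho>0: "\<And>R. R \<in> {0..1} \<Longrightarrow> 0 \<le> \<rho>0 R"
    and v: "\<And>R. R \<in> {0<..<1} \<Longrightarrow> 0 < v R \<and> v R \<le> r R"
  shows "I_pot \<rho>0 r \<le> I_pot \<rho>0 v"
  unfolding I_pot_def
proof (rule nn_integral_mono)
  fix R :: real
  show "ennreal (\<rho>0 R * (mass \<rho>0 R / r R) * R\<^sup>2) * indicator {0<..<1} R
      \<le> ennreal (\<rho>0 R * (mass \<rho>0 R / v R) * R\<^sup>2) * indicator {0<..<1} R"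
  proof (cases "R \<in> {0<..<1}")
    case True
    have "0 \<le> mass \<rho>0 R" using mass_nonneg[of \<rho>0 R] \<rho>0 True by auto
    then have "mass \<rho>0 R / r R \<le> mass \<rho>0 R / v R" using v[OF True] by (intro frac_le) auto
    then have "\<rho>0 R * (mass \<rho>0 R / r R) * R\<^sup>2 \<le> \<rho>0 R * (mass \<rho>0 R / v R) * R\<^sup>2"
      using \<rho>0[of R] True by (intro mult_right_mono mult_left_mono) auto
    then show ?thesis using True by (simp add: ennreal_leI)
  qed simp
qed

lemma I_total_less:
  assumes "I_mec \<Phi> v < I_mec \<Phi> r" "I_mec \<Phi> r < \<infinity>" "I_pot \<rho>0 r < \<infinity>" "I_pot \<rho>0 r \<le> I_pot \<rho>0 v"
  shows "I_total \<Phi> \<rho>0 v < I_total \<Phi> \<rho>0 r"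
proof -
  obtain a b p where ab: "I_mec \<Phi> v = ennreal a" "I_mec \<Phi> r = ennreal b" "I_pot \<rho>0 r = ennreal p"
      "0 \<le> a" "0 \<le> b" "0 \<le> p"
    using assms(1-3) by (metis ennreal_cases infinity_ennreal_def less_irrefl order_less_trans)
  have "a < b" using assms(1) ab by (simp add: ennreal_less_iff)
  show ?thesis
  proof (cases "I_pot \<rho>0 v")
    case (real q)
    then have "p \<le> q" using assms(4) ab by simp
    then show ?thesis using real ab \<open>a < b\<close> by (simp add: I_total_def enn2ereal_ennreal)
  next
    \<comment> \<open>An infinite potential energy of \<open>v\<close> makes its total energy minus
      infinity, while that of \<open>r\<close> is real.\<close>
    case top
    then show ?thesis using ab by (simp add: I_total_def enn2ereal_ennreal)
  qed
qed

text \<open>The indicator cuts \<open>f\<close> off to the half-line on which it is continuous;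
  \<open>u\<close>, later a weak derivative, may leave this half-line on a null set.\<close>

lemma borel_measurable_continuous_comp_pos:
  fixes f :: "real \<Rightarrow> real"
  assumes "continuous_on {0<..} f" "u \<in> borel_measurable M"
  shows "(\<lambda>x. indicator {0<..} (u x) * f (u x)) \<in> borel_measurable M"
proof -
  have "(\<lambda>t. indicator {0<..} t *\<^sub>R f t) \<in> borel_measurable borel"
    by (rule borel_measurable_continuous_on_indicator[OF _ assms(1)]) simp
  from measurable_compose[OF assms(2) this] show ?thesis by simp
qed

lemma I_mec_lebesgue_on:
  "I_mec \<Phi> r = (\<integral>\<^sup>+ R. ennreal (\<Phi> R (weak_deriv r R) (r R / R) (r R / R) * R\<^sup>2) \<partial>lebesgue_on {0<..<1})"
  unfolding I_mec_def by (subst nn_integral_restrict_space) auto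

lemma AE_lebesgue_on_iff:
  "S \<in> sets lebesgue \<Longrightarrow> (AE x in lebesgue_on S. P x) \<longleftrightarrow> (AE x in lebesgue. x \<in> S \<longrightarrow> P x)"
  by (subst AE_restrict_space_iff) auto

lemma integrable_lebesgue_on_iff:
  fixes f :: "real \<Rightarrow> real"
  shows "S \<in> sets lebesgue \<Longrightarrow> integrable (lebesgue_on S) f \<longleftrightarrow> f absolutely_integrable_on S"
  unfolding set_integrable_def by (subst integrable_restrict_space) auto

text \<open>\<open>L\<close> may change sign, so the comparison is made between real integrals.
  Finiteness of both nonnegative integrals permits the passage there and back.\<close>

lemma nn_integral_strict_less:
  assumes A: "A \<in> borel_measurable M" "AE x in M. 0 \<le> A x" "(\<integral>\<^sup>+ x. ennreal (A x) \<partial>M) < \<infinity>"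
    and B: "B \<in> borel_measurable M" "AE x in M. 0 \<le> B x"
    and L: "integrable M L" "integral\<^sup>L M L > 0" and le: "AE x in M. B x + L x \<le> A x"
    and Bfin: "(\<integral>\<^sup>+ x. ennreal (B x) \<partial>M) < \<infinity>"
  shows "(\<integral>\<^sup>+ x. ennreal (B x) \<partial>M) < (\<integral>\<^sup>+ x. ennreal (A x) \<partial>M)"
proof -
  have Ai: "integrable M A" using A by (intro integrableI_nonneg) auto
  have Bi: "integrable M B" using B Bfin by (intro integrableI_nonneg) auto
  have "integral\<^sup>L M B < integral\<^sup>L M B + integral\<^sup>L M L" using L(2) by simp
  also have "\<dots> = integral\<^sup>L M (\<lambda>x. B x + L x)" using Bi L(1) by simp
  also have "\<dots> \<le> integral\<^sup>L M A" using le by (intro integral_mono_AE Ai Bochner_Integration.integrable_add Bi L(1))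
  finally have "integral\<^sup>L M B < integral\<^sup>L M A" .
  moreover have "integral\<^sup>L M B \<ge> 0" using B(2) by (rule integral_nonneg_AE)
  ultimately show ?thesis
    using nn_integral_eq_integral[OF Ai A(2)] nn_integral_eq_integral[OF Bi B(2)]
    by (simp add: ennreal_less_iff)
qed

theorem theorem5p2:
  fixes \<rho>0 \<alpha> \<phi> h \<phi>hat hhat r :: "real \<Rightarrow> real"
    and \<Phi> :: "real \<Rightarrow> real \<Rightarrow> real \<Rightarrow> real \<Rightarrow> real"
    and k0 k1 C K q s d0 lam :: real
  assumes "0 < k0" and "0 < k1"
    and "set_borel_measurable lebesgue {0..1} \<rho>0"
    and "\<And>R. R \<in> {0..1} \<Longrightarrow> k0 \<le> \<rho>0 R \<and> \<rho>0 R \<le> k1"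
    and "\<And>R v1 v2 v3. R \<in> {0..1} \<Longrightarrow> v1 > 0 \<Longrightarrow> v2 > 0 \<Longrightarrow> v3 > 0 \<Longrightarrow>
           \<Phi> R v1 v2 v3 \<ge> \<phi>hat v1 + \<phi>hat v2 + \<phi>hat v3 + hhat (v1 * v2 * v3)"
    and "\<And>v. v > 0 \<Longrightarrow> \<phi>hat v > 0" and "strictly_convex_on {0<..} \<phi>hat"
    and "\<And>d. d > 0 \<Longrightarrow> hhat d > 0" and "strictly_convex_on {0<..} hhat"
    and "C > 0" and "1 < q" and "q < 3"
    and "\<And>v. v > 0 \<Longrightarrow> \<phi>hat v \<ge> C * v powr q"
    and "filterlim (\<lambda>d. hhat d / d) at_top at_top"
    and "K > 0" and "s \<ge> q / (q - 1)"
    and "\<And>d. d > 0 \<Longrightarrow> hhat d \<ge> K * d powr (- s)"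
    and "\<And>R v1 v2 v3. R \<in> {0..1} \<Longrightarrow> v1 > 0 \<Longrightarrow> v2 > 0 \<Longrightarrow> v3 > 0 \<Longrightarrow>
           \<Phi> R v1 v2 v3 = \<alpha> R * (\<phi> v1 + \<phi> v2 + \<phi> v3) + h (v1 * v2 * v3)"
    and "smooth_within {0..1} \<alpha>" and "\<And>R. R \<in> {0..1} \<Longrightarrow> \<alpha> R > 0"
    and "\<And>t. t > 0 \<Longrightarrow> \<phi> t \<ge> 0" and "convex_on {0<..} \<phi>" and "\<phi> differentiable_on {0<..}"
    and "strictly_convex_on {0<..} h" and "h differentiable_on {0<..}"
    and "is_arg_min h (\<lambda>d. d > 0) d0"
    and "\<And>R. R \<in> {0..1} \<Longrightarrow> vector_derivative \<alpha> (at R within {0..1}) \<le> 0"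
    and "\<And>t. t > 0 \<Longrightarrow> deriv \<phi> t \<ge> 0"
    and "lam > 0"
    and "is_arg_min (I_total \<Phi> \<rho>0) (\<lambda>u. u \<in> admissible \<Phi> lam) r"
    and "lam^3 < d0"
  shows "r 0 = 0"
proof (rule ccontr)
  note \<rho>0 = assms(4) and \<Phi>ge = assms(5) and \<phi>hat = assms(6) and hhat = assms(8)
    and \<Phi> = assms(18) and \<alpha>s = assms(19) and \<alpha>pos = assms(20) and \<phi>c = assms(22) and \<phi>d = assms(23)
    and hc = assms(24) and hd = assms(25) and d0 = assms(26) and \<alpha>dec = assms(27)
    and \<phi>inc = assms(28) and lam = assms(29) and rmin = assms(30) and lamd = assms(31)
  have \<rho>00: "\<And>R. R \<in> {0..1} \<Longrightarrow> 0 \<le> \<rho>0 R \<and> \<rho>0 R \<le> k1" using \<rho>0 assms(1) by fastforce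

  define g where "g = weak_deriv r"
  have radm: "r \<in> admissible \<Phi> lam" using rmin by (simp add: is_arg_min_def)
  then have r1: "r 1 = lam" and gpos: "AE R in lebesgue. R \<in> {0<..<1} \<longrightarrow> g R > 0"
    and "r 0 \<ge> 0" and mecfin: "I_mec \<Phi> r < \<infinity>" and rW: "r \<in> W11"
    by (auto simp: admissible_def g_def)
  assume "r 0 \<noteq> 0"
  then have r0: "r 0 > 0" using \<open>r 0 \<ge> 0\<close> by simp
  have P: "L1_primitive 0 1 r g" unfolding g_def by (rule W11_primitive[OF rW])
  have rc: "continuous_on {0..1} r" by (rule L1_primitive_continuous[OF P])
  have rge: "r 0 \<le> r R" if "R \<in> {0..1}" for R
    by (rule L1_primitive_ge_initial[OF P _ that]) (use gpos in eventually_elim, auto)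
  obtain c where c: "0 < c" "c \<le> 1" "r c = lam * c" and above: "\<And>x. x \<in> {0..c} \<Longrightarrow> lam * x \<le> r x"
    using first_crossing[OF rc r0 r1] by blast

  \<comment> \<open>The competitor as an element of \<open>W11\<close>\<close>
  define v where "v R = (if R \<le> c then lam * R else r R)" for R
  define gv where "gv R = (if R \<le> c then lam else g R)" for R
  have Pv: "L1_primitive 0 1 v gv"
  proof (rule L1_primitive_combine[of 0 c])
    have "L1_primitive 0 c (\<lambda>x. lam * x) (\<lambda>_. lam)"
      by (rule L1_primitive_C1) (auto intro!: derivative_eq_intros)
    then show "L1_primitive 0 c v gv"
      by (rule L1_primitive_cong[where N = "{}"]) (auto simp: v_def gv_def)
    have "L1_primitive c 1 r g" using L1_primitive_mono[OF P] c by simp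
    \<comment> \<open>At the junction \<open>gv\<close> takes the left value \<open>lam\<close>
      instead of \<open>g c\<close>; this single point is the exceptional null set.\<close>
    then show "L1_primitive c 1 v gv"
      by (rule L1_primitive_cong[where N = "{c}"]) (auto simp: v_def gv_def c)
  qed (use c in auto)
  have vW: "v \<in> W11" and gv: "AE R in lebesgue. R \<in> {0<..<1} \<longrightarrow> weak_deriv v R = gv R"
    using primitive_W11[OF Pv] .
  have vpos: "0 < v R" "v R \<le> r R" if "R \<in> {0<..<1}" for R
    using that lam above[of R] rge[of R] r0 by (auto simp: v_def)

  \<comment> \<open>The mechanical energies as integrals of measurable functions\<close>
  let ?M = "lebesgue_on {0<..<1::real}"
  have Ml: "{0<..<1::real} \<in> sets lebesgue" by simp
  \<comment> \<open>The stored energy of the homogeneous deformation with all three stretches equal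
    to \<open>lam\<close>. From here on \<open>q\<close> no longer denotes the growth
    exponent.\<close>
  define q where "q R = 3 * \<alpha> R * \<phi> lam + h (lam ^ 3)" for R
  define \<phi>0 where "\<phi>0 t = indicator {0<..} t * \<phi> t" for t
  define h0 where "h0 t = indicator {0<..} t * h t" for t
  \<comment> \<open>\<open>A\<close> and \<open>B\<close> agree almost everywhere with the
    integrands of the mechanical energies of \<open>r\<close> and \<open>v\<close>; the cutoffs
    \<open>\<phi>0\<close> and \<open>h0\<close> make them measurable.\<close>
  define A where "A R = (\<alpha> R * (\<phi>0 (g R) + 2 * \<phi>0 (r R / R)) + h0 (g R * (r R / R) * (r R / R))) * R\<^sup>2" for R
  define B where "B R = (if R \<le> c then q R * R\<^sup>2 else A R)" for R
  have AEg: "AE R in ?M. R \<in> {0<..<1} \<and> g R > 0"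
    using gpos by (simp add: AE_lebesgue_on_iff)
  have AEgv: "AE R in ?M. weak_deriv v R = gv R"
    using gv by (simp add: AE_lebesgue_on_iff)
  \<comment> \<open>\<open>h\<close> carries no sign condition of its own; the sign of the sum comes
    from the positive lower bounds \<open>\<phi>hat\<close> and \<open>hhat\<close>.\<close>
  have \<Phi>nonneg: "0 \<le> \<Phi> R x y y" if "R \<in> {0<..<1}" "x > 0" "y > 0" for R x y
    using \<Phi>ge[of R x y y] \<phi>hat[of x] \<phi>hat[of y] hhat[of "x * y * y"] that by simp
  have A\<Phi>: "A R = \<Phi> R (g R) (r R / R) (r R / R) * R\<^sup>2" if "R \<in> {0<..<1}" "g R > 0" for R
    using that rge[of R] r0 by (simp add: A_def \<Phi> \<phi>0_def h0_def)
  have "0 \<le> A R" if "R \<in> {0<..<1}" "g R > 0" for R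
    using that rge[of R] r0 by (simp add: A\<Phi> \<Phi>nonneg)
  then have A0: "AE R in ?M. 0 \<le> A R"
    using AEg by (auto elim: eventually_mono)
  have q\<Phi>: "q R = \<Phi> R lam lam lam" if "R \<in> {0<..<1}" for R
    using that lam by (simp add: q_def \<Phi> power3_eq_cube)
  have q0: "0 \<le> q R" if "R \<in> {0<..<1}" for R
    using \<Phi>nonneg[of R lam lam] q\<Phi> that lam by simp
  have B0: "AE R in ?M. 0 \<le> B R"
    using A0 AEg by eventually_elim (simp add: B_def q0)
  have mecA: "I_mec \<Phi> r = (\<integral>\<^sup>+ R. ennreal (A R) \<partial>?M)"
    unfolding I_mec_lebesgue_on g_def[symmetric]
    by (rule nn_integral_cong_AE) (use AEg in \<open>eventually_elim, simp add: A\<Phi>\<close>)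
  have mecB: "I_mec \<Phi> v = (\<integral>\<^sup>+ R. ennreal (B R) \<partial>?M)"
    unfolding I_mec_lebesgue_on
  proof (rule nn_integral_cong_AE)
    show "AE R in ?M. ennreal (\<Phi> R (weak_deriv v R) (v R / R) (v R / R) * R\<^sup>2) = ennreal (B R)"
      using AEg AEgv by eventually_elim (simp add: A\<Phi> B_def q\<Phi> v_def gv_def)
  qed

  \<comment> \<open>Regularity of \<alpha> and measurability of the integrands\<close>
  obtain \<alpha>' where \<alpha>': "\<And>x. x \<in> {0..1} \<Longrightarrow> (\<alpha> has_real_derivative \<alpha>' x) (at x within {0..1})"
    and \<alpha>'c: "continuous_on {0..1} \<alpha>'"
  proof -
    obtain D where D0: "\<And>x. x \<in> {0..1} \<Longrightarrow> D 0 x = \<alpha> x"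
      and D: "\<And>n x. x \<in> {0..1} \<Longrightarrow> (D n has_real_derivative D (Suc n) x) (at x within {0..1})"
      using \<alpha>s unfolding smooth_within_def by blast
    show thesis
    \<comment> \<open>\<open>D 0\<close> agrees with \<alpha> only on the unit interval, so the
      derivative is transferred within it. \<open>D 1\<close> is continuous because it has the
      derivative \<open>D 2\<close>.\<close>
    proof (rule that[of "D 1"])
      show "(\<alpha> has_real_derivative D 1 x) (at x within {0..1})" if "x \<in> {0..1}" for x
        by (rule has_field_derivative_transform_within[OF _ zero_less_one that, of "D 0"])
          (use D[OF that, of 0] D0 in auto)
      show "continuous_on {0..1} (D 1)"
        using D[of _ 1] by (intro DERIV_continuous_on)
    qed
  qed
  have \<alpha>'neg: "\<alpha>' x \<le> 0" if "x \<in> {0..1}" for x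
  proof -
    have "vector_derivative \<alpha> (at x within {0..1}) = \<alpha>' x"
      using \<alpha>'[OF that] that
      by (intro vector_derivative_within_cbox[of 0 1, simplified])
        (auto simp: has_real_derivative_iff_has_vector_derivative)
    then show ?thesis using \<alpha>dec[OF that] by simp
  qed
  have P\<alpha>: "L1_primitive 0 1 \<alpha> \<alpha>'" by (rule L1_primitive_C1[OF \<alpha>' \<alpha>'c])
  have \<alpha>c: "continuous_on {0..1} \<alpha>" by (rule L1_primitive_continuous[OF P\<alpha>])

  have [measurable]: "g \<in> borel_measurable ?M" "\<alpha> \<in> borel_measurable ?M" "r \<in> borel_measurable ?M"
  proof -
    have "g absolutely_integrable_on {0<..<1}"
      by (rule set_integrable_subset[OF L1_primitiveD(1)[OF P]]) auto
    then show "g \<in> borel_measurable ?M" by (simp add: absolutely_integrable_measurable)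
    show "\<alpha> \<in> borel_measurable ?M" "r \<in> borel_measurable ?M"
      by (intro continuous_imp_measurable_on_sets_lebesgue;
          force intro: continuous_on_subset[OF \<alpha>c] continuous_on_subset[OF rc])+
  qed
  have [measurable]: "(\<lambda>R. R) \<in> borel_measurable ?M"
    by (intro continuous_imp_measurable_on_sets_lebesgue continuous_intros) simp
  have [measurable]: "(\<lambda>R. \<phi>0 (f R)) \<in> borel_measurable ?M" "(\<lambda>R. h0 (f R)) \<in> borel_measurable ?M"
    if [measurable]: "f \<in> borel_measurable ?M" for f
    unfolding \<phi>0_def h0_def using \<phi>d hd that
    by (auto intro!: borel_measurable_continuous_comp_pos differentiable_imp_continuous_on)
  have Am[measurable]: "A \<in> borel_measurable ?M" unfolding A_def[abs_def] by measurable
  have Bm: "B \<in> borel_measurable ?M" unfolding B_def[abs_def] q_def by measurable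

  \<comment> \<open>The pointwise energy gain from the tangent lines\<close>
  define p where "p = deriv \<phi> lam"
  define k where "k = deriv h (lam ^ 3)"
  have p: "p \<ge> 0" unfolding p_def using \<phi>inc lam by simp
  have k: "k < 0" unfolding k_def
    using lam lamd by (intro deriv_neg_left_of_strict_convex_minimum[OF hc hd d0]) simp_all
  define L where "L x = p * (\<alpha> x * ((g x - lam) * x\<^sup>2 + 2 * x * (r x - lam * x)))
                    + k * ((r x)\<^sup>2 * g x - lam ^ 3 * x\<^sup>2)" for x
  have Li: "L absolutely_integrable_on {0..c}" and Lpos: "integral {0..c} L > 0"
    unfolding L_def
    using tangent_remainder_integral_pos[of c r g \<alpha> \<alpha>' lam p k] above c p k r0 \<alpha>'neg
      L1_primitive_mono[OF P, of 0 c] L1_primitive_mono[OF P\<alpha>, of 0 c] by simp_all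
  have gain: "q R * R\<^sup>2 + L R \<le> A R" if R: "R \<in> {0<..<1}" "R \<le> c" "g R > 0" for R
  proof -
    \<comment> \<open>In terms of the hoop stretch \<open>y\<close>, \<open>L R\<close> is
      \<open>R\<^sup>2\<close> times the sum of the linear parts of the tangents: those of \<phi> at
      \<open>lam\<close>, once for \<open>g R\<close> and twice for \<open>y\<close> and weighted by
      \<alpha>, and that of \<open>h\<close> at \<open>lam ^ 3\<close>.\<close>
    define y where "y = r R / R"
    have y: "y > 0" "r R = y * R" using R rge[of R] r0 by (auto simp: y_def)
    have t1: "\<phi> lam + p * (t - lam) \<le> \<phi> t" if "t > 0" for t
      unfolding p_def using that lam by (intro convex_on_pos_tangent \<phi>c \<phi>d)
    have "\<phi> lam + p * (g R - lam) + 2 * (\<phi> lam + p * (y - lam)) \<le> \<phi> (g R) + 2 * \<phi> y"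
      using t1[of "g R"] t1[of y] R y by simp
    then have "\<alpha> R * (\<phi> lam + p * (g R - lam) + 2 * (\<phi> lam + p * (y - lam))) \<le> \<alpha> R * (\<phi> (g R) + 2 * \<phi> y)"
      using \<alpha>pos[of R] R by (intro mult_left_mono) auto
    moreover have "h (lam ^ 3) + k * (g R * y * y - lam ^ 3) \<le> h (g R * y * y)"
      unfolding k_def using lam R y
      by (intro convex_on_pos_tangent strictly_convex_on_imp_convex_on hc hd) auto
    ultimately have "(\<alpha> R * (\<phi> lam + p * (g R - lam) + 2 * (\<phi> lam + p * (y - lam)))
        + (h (lam ^ 3) + k * (g R * y * y - lam ^ 3))) * R\<^sup>2
      \<le> (\<alpha> R * (\<phi> (g R) + 2 * \<phi> y) + h (g R * y * y)) * R\<^sup>2"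
      by (intro mult_right_mono add_mono) auto
    moreover have "A R = (\<alpha> R * (\<phi> (g R) + 2 * \<phi> y) + h (g R * y * y)) * R\<^sup>2"
      using R y(1) unfolding A_def y_def[symmetric] by (simp add: \<phi>0_def h0_def)
    moreover have "q R * R\<^sup>2 + L R = (\<alpha> R * (\<phi> lam + p * (g R - lam) + 2 * (\<phi> lam + p * (y - lam)))
        + (h (lam ^ 3) + k * (g R * y * y - lam ^ 3))) * R\<^sup>2"
      unfolding q_def L_def y(2) by (simp add: power2_eq_square algebra_simps)
    ultimately show ?thesis by simp
  qed

  \<comment> \<open>Beyond \<open>c\<close> the deformations coincide, so the gain is continued by
    0.\<close>
  define LL where "LL R = (if R \<le> c then L R else 0)" for R
  have LLeq: "indicator {0<..<1} R *\<^sub>R LL R = indicator ({0<..<1} \<inter> {0..c}) R *\<^sub>R L R" for R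
    by (auto simp: LL_def indicator_def)
  have Li': "L absolutely_integrable_on {0<..<1} \<inter> {0..c}"
    by (rule set_integrable_subset[OF Li]) auto
  have LLi: "integrable ?M LL"
    using Li' unfolding integrable_lebesgue_on_iff[OF Ml] set_integrable_def LLeq .
  have "integral\<^sup>L ?M LL = (LINT R:{0<..<1} \<inter> {0..c}|lebesgue. L R)"
    unfolding set_lebesgue_integral_def LLeq[symmetric] by (subst integral_restrict_space) auto
  also have "\<dots> = integral ({0<..<1} \<inter> {0..c}) L" by (rule set_lebesgue_integral_eq_integral(2)[OF Li'])
  also have "\<dots> = integral {0..c} L"
  proof (rule integral_spike_set)
    show "negligible {x \<in> {0<..<1} \<inter> {0..c} - {0..c}. L x \<noteq> 0}"
      by (rule negligible_subset[of "{}"]) auto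
    \<comment> \<open>The pair of points covers both cases: for \<open>c < 1\<close> only 0 is
      missing, for \<open>c = 1\<close> also 1.\<close>
    show "negligible {x \<in> {0..c} - {0<..<1} \<inter> {0..c}. L x \<noteq> 0}"
      by (rule negligible_subset[of "{0, 1}"]) (use c in auto)
  qed
  finally have LLpos: "integral\<^sup>L ?M LL > 0" using Lpos by simp

  \<comment> \<open>Energy comparison and contradiction to minimality\<close>
  have qb: "integrable ?M (\<lambda>R. q R * R\<^sup>2)"
  proof -
    have "(\<lambda>R. q R * R\<^sup>2) absolutely_integrable_on {0..1}"
      unfolding q_def by (intro absolutely_integrable_continuous_real continuous_intros \<alpha>c)
    then have "(\<lambda>R. q R * R\<^sup>2) absolutely_integrable_on {0<..<1}"
      by (rule set_integrable_subset) auto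
    then show ?thesis by (simp add: integrable_lebesgue_on_iff)
  qed
  have Ai: "integrable ?M A" using Am A0 mecfin mecA by (intro integrableI_nonneg) auto
  have "integrable ?M B"
  proof (rule Bochner_Integration.integrable_bound)
    show "integrable ?M (\<lambda>R. \<bar>q R * R\<^sup>2\<bar> + \<bar>A R\<bar>)" using qb Ai by simp
    show "AE R in ?M. norm (B R) \<le> norm (\<bar>q R * R\<^sup>2\<bar> + \<bar>A R\<bar>)" by (simp add: B_def)
  qed (rule Bm)
  then have Bfin: "(\<integral>\<^sup>+ R. ennreal (B R) \<partial>?M) < \<infinity>"
    using B0 by (simp add: nn_integral_eq_integral)
  have "AE R in ?M. B R + LL R \<le> A R"
    using AEg by eventually_elim (auto simp: B_def LL_def gain)
  then have less: "I_mec \<Phi> v < I_mec \<Phi> r"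
    unfolding mecA mecB
    using Am A0 mecfin[unfolded mecA] Bm B0 LLi LLpos Bfin by (intro nn_integral_strict_less)
  have "v \<in> admissible \<Phi> lam"
  proof -
    have "AE R in lebesgue. R \<in> {0<..<1} \<longrightarrow> weak_deriv v R > 0"
      using gv gpos by eventually_elim (use lam in \<open>auto simp: gv_def\<close>)
    moreover have "v 1 = lam" using c r1 by (auto simp: v_def)
    moreover have "v 0 = 0" using c by (simp add: v_def)
    \<comment> \<open>Finite mechanical energy of \<open>v\<close> follows from the strict
      inequality \<open>less\<close>.\<close>
    ultimately show ?thesis using vW less mecfin by (auto simp: admissible_def)
  qed
  moreover have "I_total \<Phi> \<rho>0 v < I_total \<Phi> \<rho>0 r"
  proof (rule I_total_less[OF less mecfin])
    show "I_pot \<rho>0 r < \<infinity>" by (rule I_pot_finite[OF \<rho>00 r0 rge])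
    show "I_pot \<rho>0 r \<le> I_pot \<rho>0 v"
      by (rule I_pot_antimono) (use \<rho>00 vpos in auto)
  qed
  ultimately show False using rmin by (auto simp: is_arg_min_def)
qed

end
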